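(* For every integer $N\ge0$, $$[t^{2N}]G(t,q)=\dfrac{1}{(1-q)^{2N+1}}\sum\limits_{m=0}^{N}\dfrac{q^{m^2+2m}\left(\sum\limits_{l=-m}^{m+1}(-1)^l q^{-l^2+2l}\right)(2m+2)\binom{2N+1}{N+m+1}}{N+m+2}\,,$$ where $[t^{2N}]G(t,q)$ denotes the coefficient of $t^{2N}$ in $G(t,q)$.
   Context: A Dyck path of length $2N$ is a lattice path from $(0,0)$ to $(2N,0)$ with $N$ steps $(1,1)$ and $N$ steps $(1,-1)$ that never goes below $y=0$. Its steps are labelled: $a_j$ is a step $(1,1)$ starting at height $j\ge 0$, and $b_k$ is a step $(1,-1)$ starting at height $k\ge1$. Thus a Dyck path is encoded as a word $u_1u_2\cdots u_{2N}$ in these labels. Given a possibility function $pos:\{a_0,a_1,\ldots\}\cup\{b_1,b_2,\ldots\}\to\mathbb{N}_0$, a path diagram is a Dyck path $u_1\cdots u_{2N}$ together with a sequence of integers $s_1,\ldots,s_{2N}$ with $0\le s_i\le pos(u_i)$ for all $i$. Here the possibility function is $pos(a_j)=j$ for $j\ge0$, $pos(b_k)=k$ for $k\ge1$. The generating function of unrestricted path diagrams is the formal power series $$G(t,q)=\sum_{N,m\ge0}a_{N,m}t^{2N}q^m,$$ where $a_{N,m}$ is the number of such path diagrams whose Dyck path has length $2N$ (no restriction on height) and with $s_1+\cdots+s_{2N}=m$ (the empty path counts once for $N=m=0$). For each $N$ the coefficient of $t^{2N}$ is a polynomial in $q$. *)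

theory Defs
  imports "HOL-Computational_Algebra.Formal_Laurent_Series"
begin

datatype step = Up | Down

fun step_rise :: "step \<Rightarrow> int" where
  "step_rise Up = 1"
| "step_rise Down = -1"

definition height :: "step list \<Rightarrow> nat \<Rightarrow> int" where
  "height p i = (\<Sum>k<i. step_rise (p ! k))"

definition dyck_paths :: "nat \<Rightarrow> step list set" where
  "dyck_paths N = {p. length p = 2 * N \<and> count_list p Up = N \<and> count_list p Down = N \<and>
     (\<forall>i\<le>2 * N. height p i \<ge> 0)}"

text \<open>\<open>A_step j\<close> is the label $a_j$ and \<open>B_step k\<close> the label $b_k$. The value \<open>B_step 0\<close> exists in
  the type, but a down-step of a Dyck path starts at height at least 1, so it never occurs.\<close>

datatype label = A_step nat | B_step nat

definition step_label :: "step list \<Rightarrow> nat \<Rightarrow> label" where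
  "step_label p i =
     (case p ! i of Up \<Rightarrow> A_step (nat (height p i)) | Down \<Rightarrow> B_step (nat (height p i)))"

definition path_diagrams :: "(label \<Rightarrow> nat) \<Rightarrow> nat \<Rightarrow> (step list \<times> nat list) set" where
  "path_diagrams possib N = {(p, s). p \<in> dyck_paths N \<and> length s = 2 * N \<and>
     (\<forall>i<2 * N. s ! i \<le> possib (step_label p i))}"

fun pos :: "label \<Rightarrow> nat" where
  "pos (A_step j) = j"
| "pos (B_step k) = k"

definition num_diagrams :: "nat \<Rightarrow> nat \<Rightarrow> nat" where
  "num_diagrams N m = card {(p, s) \<in> path_diagrams pos N. sum_list s = m}"

text \<open>The set counted by \<open>num_diagrams\<close> is finite, so \<open>card\<close> is the true count.
  \<open>G\<close> is a power series in $t$ whose coefficients are power series in $q$; only even powers of $t$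
  occur. The coefficient of $t^{2N}$ is embedded into the field of formal Laurent series in $q$ when
  negative powers of $q$ and division by $1-q$ are needed.\<close>

definition G :: "rat fps fps" where
  "G = Abs_fps (\<lambda>n. if even n then Abs_fps (\<lambda>m. of_nat (num_diagrams (n div 2) m)) else 0)"

end

theory Submission
  imports Defs
begin

text \<open>A step leaving height $h$ carries the weight $1+q+\cdots+q^h$, so after multiplication by
  $(1-q)^{2N}$ the generating function is the moment $L(x^{2N})$ of the monic orthogonal polynomials
  $P_h$ with $x P_h = P_{h+1} + (1-q^h)(1-q^{h+1}) P_{h-1}$. The $q$-Hermite polynomials, given by
  $x H_k = H_{k+1} + (1-q^k) H_{k-1}$, have an explicit expansion both in the $P_h$ and in the
  Chebyshev polynomials $U_m$. The first one gives the values $L(H_k)$. The second one reduces the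
  theorem to checking that the values for $L(U_m)$ read off the theta sums of the statement lead to
  the same $L(H_k)$, since $x^n$ is a combination of the $U_m$ with binomial coefficients. That check
  only uses the first-order recurrence of the theta sums and their odd continuation to negative
  indices.\<close>

section \<open>Pascal's rule under a sum, and a shift of summation index\<close>

lemma sum_choose_Suc:
  fixes F :: "nat \<Rightarrow> 'a::comm_ring_1"
  shows "(\<Sum>k\<le>Suc n. of_nat (Suc n choose k) * F k) =
    (\<Sum>k\<le>n. of_nat (n choose k) * (F k + F (Suc k)))"
proof -
  have "(\<Sum>k\<le>Suc n. of_nat (Suc n choose k) * F k) =
      F 0 + (\<Sum>k\<le>n. of_nat (n choose k) * F (Suc k)) +
        (\<Sum>k\<le>n. of_nat (n choose Suc k) * F (Suc k))"
    by (simp add: sum.atMost_Suc_shift sum.distrib ring_distribs del: sum.atMost_Suc)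
  also have "F 0 + (\<Sum>k\<le>n. of_nat (n choose Suc k) * F (Suc k)) =
      (\<Sum>k\<le>Suc n. of_nat (n choose k) * F k)"
    by (simp add: sum.atMost_Suc_shift del: sum.atMost_Suc)
  hence "F 0 + (\<Sum>k\<le>n. of_nat (n choose k) * F (Suc k)) +
        (\<Sum>k\<le>n. of_nat (n choose Suc k) * F (Suc k)) =
      (\<Sum>k\<le>n. of_nat (n choose k) * F k) + (\<Sum>k\<le>n. of_nat (n choose k) * F (Suc k))"
    by (simp add: algebra_simps binomial_eq_0)
  finally show ?thesis
    by (simp add: sum.distrib ring_distribs)
qed

lemma sum_int_shift:
  fixes F :: "int \<Rightarrow> 'a::comm_monoid_add"
  shows "(\<Sum>j=a..b. F (j + d)) = (\<Sum>j=a+d..b+d. F j)"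
  by (rule sum.reindex_bij_witness[of _ "\<lambda>j. j - d" "\<lambda>j. j + d"]) auto

section \<open>Convolutions with reciprocal q-factorials\<close>

text \<open>\<open>q\<close> is not a root of unity, so that every \<open>1 - q ^ n\<close> with
  \<open>n > 0\<close> is invertible. The Laurent variable will be the instance.\<close>

locale q_param =
  fixes q :: "'a::field_char_0"
  assumes q_nz: "q \<noteq> 0" and q_pow: "\<And>n. n > 0 \<Longrightarrow> q ^ n \<noteq> 1"
begin

lemma q_powi_add: "q powi (a + b) = q powi a * q powi b"
  using q_nz by (simp add: power_int_add)

text \<open>The extension of $1/(q;q)_i$ by zero to negative \<open>i\<close> makes \<open>rec_step\<close> valid for all
  integers.\<close>

definition rec :: "int \<Rightarrow> 'a" where
  "rec i = (if i < 0 then 0 else inverse (\<Prod>k=1..nat i. 1 - q ^ k))"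

lemma rec_neg: "i < 0 \<Longrightarrow> rec i = 0"
  by (simp add: rec_def)

lemma rec_0 [simp]: "rec 0 = 1"
  by (simp add: rec_def)

lemma rec_step: "(1 - q powi i) * rec i = rec (i - 1)"
proof (cases "i > 0")
  case True
  then obtain n where i: "i = int (Suc n)"
    by (metis gr0_conv_Suc zero_less_imp_eq_int)
  have "1 - q ^ Suc n \<noteq> 0"
    using q_pow[of "Suc n"] by simp
  moreover have "q powi i = q ^ Suc n" "nat i = Suc n" "nat (i - 1) = n"
    by (simp_all add: i power_int_def nat_add_distrib)
  ultimately show ?thesis
    using True by (simp add: rec_def del: power_Suc)
next
  case False
  thus ?thesis
    by (cases "i = 0") (auto simp: rec_def)
qed

text \<open>Multiplied by (q;q)_n, this sums \<open>F j\<close> against the Gaussian binomials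
  [n, j].\<close>

definition conv :: "int \<Rightarrow> (int \<Rightarrow> 'a) \<Rightarrow> 'a" where
  "conv n F = (\<Sum>j=0..n. rec j * rec (n - j) * F j)"

lemma conv_neg [simp]: "n < 0 \<Longrightarrow> conv n F = 0"
  by (simp add: conv_def)

lemma conv_0 [simp]: "conv 0 F = F 0"
  by (simp add: conv_def)

lemma conv_cong: "(\<And>j. F j = F' j) \<Longrightarrow> n = n' \<Longrightarrow> conv n F = conv n' F'"
  by (simp add: conv_def)

lemma conv_add: "conv n (\<lambda>j. F j + F' j) = conv n F + conv n F'"
  by (simp add: conv_def sum.distrib ring_distribs)

lemma conv_diff: "conv n (\<lambda>j. F j - F' j) = conv n F - conv n F'"
  by (simp add: conv_def sum_subtractf ring_distribs)

lemma conv_cmult: "conv n (\<lambda>j. x * F j) = x * conv n F"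
  by (simp add: conv_def sum_distrib_left mult_ac)

lemma conv_minus: "conv n (\<lambda>j. - F j) = - conv n F"
  by (simp add: conv_def sum_negf)

lemma conv_flip: "conv n F = conv n (\<lambda>j. F (n - j))"
  unfolding conv_def
  by (rule sum.reindex_bij_witness[of _ "\<lambda>j. n - j" "\<lambda>j. n - j"]) (auto simp: mult_ac)

text \<open>The weight cancels the last factor of (q;q)_(n-j) by \<open>rec_step\<close>; the term
  \<open>j = n\<close> drops out because \<open>rec (-1) = 0\<close>.\<close>

lemma conv_right: "conv n (\<lambda>j. (1 - q powi (n - j)) * F j) = conv (n - 1) F"
proof -
  have "conv n (\<lambda>j. (1 - q powi (n - j)) * F j) =
      (\<Sum>j=0..n. rec j * ((1 - q powi (n - j)) * rec (n - j)) * F j)"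
    by (simp add: conv_def mult_ac)
  also have "\<dots> = (\<Sum>j=0..n. rec j * rec (n - 1 - j) * F j)"
    by (simp only: rec_step) (simp add: algebra_simps)
  also have "\<dots> = (\<Sum>j=0..n - 1. rec j * rec (n - 1 - j) * F j)"
    by (rule sum.mono_neutral_right) (auto simp: rec_neg)
  finally show ?thesis
    by (simp add: conv_def)
qed

lemma conv_left: "conv n (\<lambda>j. (1 - q powi j) * F j) = conv (n - 1) (\<lambda>j. F (j + 1))"
proof -
  have "conv n (\<lambda>j. (1 - q powi j) * F j) = conv n (\<lambda>j. (1 - q powi (n - j)) * F (n - j))"
    by (rule conv_flip)
  also have "\<dots> = conv (n - 1) (\<lambda>j. F (n - j))"
    by (rule conv_right)
  also have "\<dots> = conv (n - 1) (\<lambda>j. F (n - (n - 1 - j)))"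
    by (rule conv_flip)
  finally show ?thesis
    by (simp add: algebra_simps)
qed

text \<open>Gauss's alternating sum of Gaussian binomials, divided by (q;q)_n.\<close>

definition alt :: "int \<Rightarrow> 'a" where
  "alt n = conv n (\<lambda>j. (-1) powi j)"

lemma alt_neg [simp]: "n < 0 \<Longrightarrow> alt n = 0"
  by (simp add: alt_def)

lemma alt_0 [simp]: "alt 0 = 1"
  by (simp add: alt_def)

lemma m1_powi_add: "(-1 :: 'a) powi (a + b) = (-1) powi a * (-1) powi b"
  by (simp add: power_int_add)

lemma m1_powi_diff: "(-1 :: 'a) powi (a - b) = (-1) powi a * (-1) powi b"
  by (simp add: power_int_diff power_int_minus_left)

text \<open>In q^j = 1 - (1 - q^j) the second part lowers \<open>n\<close> by
  \<open>conv_left\<close>, whose index shift flips the sign.\<close>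

lemma conv_alt_q: "conv n (\<lambda>j. (-1) powi j * q powi j) = alt n + alt (n - 1)"
proof -
  have "conv n (\<lambda>j. (1 - q powi j) * (-1) powi j) = - alt (n - 1)"
    unfolding conv_left alt_def by (simp add: m1_powi_add conv_minus)
  moreover have "conv n (\<lambda>j. (1 - q powi j) * (-1) powi j) =
      alt n - conv n (\<lambda>j. (-1) powi j * q powi j)"
    unfolding alt_def conv_diff[symmetric] by (rule conv_cong) (auto simp: algebra_simps)
  ultimately show ?thesis
    by (simp add: algebra_simps)
qed

text \<open>In 1 - q^n = (1 - q^j) + q^j (1 - q^(n-j)) each part lowers \<open>n\<close> by one; by
  \<open>conv_alt_q\<close> the two \<open>alt (n - 1)\<close> cancel.\<close>

lemma alt_step: "(1 - q powi n) * alt n = alt (n - 2)"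
proof -
  have "(1 - q powi n) * alt n =
      conv n (\<lambda>j. (1 - q powi j) * (-1) powi j + (1 - q powi (n - j)) * ((-1) powi j * q powi j))"
    unfolding alt_def conv_cmult[symmetric]
  proof (rule conv_cong)
    fix j show "(1 - q powi n) * (-1) powi j =
        (1 - q powi j) * (-1) powi j + (1 - q powi (n - j)) * ((-1) powi j * q powi j)"
      using q_powi_add[of "n - j" j] by (simp add: algebra_simps)
  qed simp
  also have "\<dots> = - alt (n - 1) + conv (n - 1) (\<lambda>j. (-1) powi j * q powi j)"
    unfolding conv_add conv_right conv_left alt_def by (simp add: m1_powi_add conv_minus)
  finally show ?thesis
    by (simp add: conv_alt_q)
qed

lemma alt_odd: "odd n \<Longrightarrow> alt n = 0"
proof -
  assume n: "odd n"
  have "alt n = conv n (\<lambda>j. (-1) powi (n - j))"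
    unfolding alt_def by (rule conv_flip)
  also have "\<dots> = - alt n"
    unfolding alt_def m1_powi_diff conv_cmult using n by simp
  finally show ?thesis
    by simp
qed

text \<open>By \<open>alt_step\<close> this is $(-q^2)^j/(q^2;q^2)_j$, so that
  $H_k/(q;q)_k$ is the sum of the \<open>hcoeff j\<close> times $P_{k-2j}/(q;q)_{k-2j}$.\<close>

definition hcoeff :: "int \<Rightarrow> 'a" where
  "hcoeff j = (-1) powi j * q powi (2 * j) * alt (2 * j)"

lemma hcoeff_neg [simp]: "j < 0 \<Longrightarrow> hcoeff j = 0"
  by (simp add: hcoeff_def)

lemma hcoeff_step: "(1 - q powi (2 * j)) * hcoeff j = - (q\<^sup>2 * hcoeff (j - 1))"
proof -
  have "(1 - q powi (2 * j)) * hcoeff j = (-1) powi j * q powi (2 * j) * alt (2 * j - 2)"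
    unfolding hcoeff_def alt_step[symmetric] by (simp add: algebra_simps)
  moreover have "q powi (2 * j) = q\<^sup>2 * q powi (2 * (j - 1))"
    using q_powi_add[of 2 "2 * (j - 1)"] by (simp add: algebra_simps)
  moreover have "(-1 :: 'a) powi j = - ((-1) powi (j - 1))"
    by (simp add: m1_powi_diff)
  ultimately show ?thesis
    by (simp add: hcoeff_def algebra_simps)
qed

section \<open>The partial theta sums\<close>

text \<open>Integer argument, so that the recurrence can start at \<open>m = -1\<close>, where the
  range of \<open>l\<close> is empty.\<close>

definition ptheta :: "int \<Rightarrow> 'a" where
  "ptheta m = q powi (m\<^sup>2 + 2 * m) * (\<Sum>l=-m..m+1. (-1) powi l * q powi (- (l\<^sup>2) + 2 * l))"

text \<open>The odd continuation about $-1$ makes \<open>theta_step\<close> valid for all integers.\<close>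

definition theta :: "int \<Rightarrow> 'a" where
  "theta m = (if m \<ge> -1 then ptheta m else - ptheta (- 2 - m))"

text \<open>Raising \<open>m\<close> adds the end terms \<open>l = -m\<close> and
  \<open>l = m + 1\<close>; times the prefactor they give the two inhomogeneous parts.\<close>

lemma ptheta_step:
  assumes "m \<ge> 0"
  shows "ptheta m = q powi (2 * m + 1) * ptheta (m - 1) + (-1) powi m * (1 - q powi (2 * m + 1))"
proof -
  define t where "t l = (-1) powi l * q powi (- (l\<^sup>2) + 2 * l)" for l
  have "{-m..m+1} = insert (-m) (insert (m+1) {-(m-1)..m-1+1})"
    using assms by auto
  hence "(\<Sum>l=-m..m+1. t l) = t (-m) + t (m + 1) + (\<Sum>l=-(m-1)..m-1+1. t l)"
    using assms by simp
  hence "ptheta m = q powi (m\<^sup>2 + 2 * m) * t (-m) + q powi (m\<^sup>2 + 2 * m) * t (m + 1) +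
      q powi (m\<^sup>2 + 2 * m) * (\<Sum>l=-(m-1)..m-1+1. t l)"
    by (simp add: ptheta_def t_def algebra_simps)
  also have "q powi (m\<^sup>2 + 2 * m) = q powi (2 * m + 1) * q powi ((m - 1)\<^sup>2 + 2 * (m - 1))"
    unfolding q_powi_add[symmetric] by (simp add: power2_eq_square algebra_simps)
  hence "q powi (m\<^sup>2 + 2 * m) * (\<Sum>l=-(m-1)..m-1+1. t l) = q powi (2 * m + 1) * ptheta (m - 1)"
    by (simp add: ptheta_def t_def)
  also have "q powi (m\<^sup>2 + 2 * m) * t (-m) = (-1) powi m"
  proof -
    have "q powi (m\<^sup>2 + 2 * m) * q powi (- ((-m)\<^sup>2) + 2 * (-m)) = 1"
      unfolding q_powi_add[symmetric] by simp
    thus ?thesis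
      by (simp add: t_def power_int_minus_left)
  qed
  also have "q powi (m\<^sup>2 + 2 * m) * t (m + 1) = - ((-1) powi m * q powi (2 * m + 1))"
  proof -
    have "q powi (m\<^sup>2 + 2 * m) * q powi (- ((m+1)\<^sup>2) + 2 * (m+1)) = q powi (2 * m + 1)"
      unfolding q_powi_add[symmetric] by (simp add: power2_eq_square algebra_simps)
    thus ?thesis
      by (simp add: t_def m1_powi_add mult_ac)
  qed
  finally show ?thesis
    by (simp add: algebra_simps)
qed

lemma ptheta_m1 [simp]: "ptheta (-1) = 0"
  by (simp add: ptheta_def)

lemma theta_refl: "theta (- 2 - m) = - theta m"
  by (cases "m = -1") (auto simp: theta_def)

lemma theta_step:
  "theta m = q powi (2 * m + 1) * theta (m - 1) + (-1) powi m * (1 - q powi (2 * m + 1))"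
proof (cases "m \<ge> 0")
  case True
  thus ?thesis
    using ptheta_step[OF True] by (simp add: theta_def)
next
  case False
  \<comment> \<open>The reflection about -1 carries \<open>m\<close>, \<open>m - 1\<close> to
    \<open>p - 1\<close>, \<open>p\<close>. The claim becomes \<open>ptheta_step\<close> at
    \<open>p\<close>, divided by q^(2p+1).\<close>
  define p where "p = -1 - m"
  have p: "p \<ge> 0" "m = - 2 - (p - 1)" "m - 1 = - 2 - p"
    using False by (auto simp: p_def)
  have "theta m = - theta (p - 1)" "theta (m - 1) = - theta p"
    using theta_refl[of "p - 1"] theta_refl[of p] unfolding p(2,3)[symmetric] by simp_all
  hence "theta m = - ptheta (p - 1)" "theta (m - 1) = - ptheta p"
    using p(1) by (simp_all add: theta_def)
  moreover have "q powi (2 * m + 1) * q powi (2 * p + 1) = 1"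
    unfolding q_powi_add[symmetric] by (simp add: p_def)
  hence inv: "q powi (2 * m + 1) * q powi (2 * p + 1) = 1"
      "q powi (2 * m + 1) * (q powi (2 * p + 1) * x) = x" for x
    by (simp_all flip: mult.assoc)
  moreover have "(-1 :: 'a) powi m = - ((-1) powi p)"
    by (simp add: p_def m1_powi_diff power_int_minus_left)
  ultimately show ?thesis
    unfolding ptheta_step[OF p(1)] by (simp add: ring_distribs mult.left_commute inv)
qed

text \<open>Reversing the convolution reflects the argument about -1, where \<open>theta\<close> is
  odd.\<close>

lemma conv_theta_eq_0: "conv (2 * n) (\<lambda>j. theta (n - j - 1)) = 0"
proof -
  have "conv (2 * n) (\<lambda>j. theta (n - j - 1)) = conv (2 * n) (\<lambda>j. theta (n - (2 * n - j) - 1))"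
    by (rule conv_flip)
  also have "\<dots> = conv (2 * n) (\<lambda>j. - theta (n - j - 1))"
  proof (rule conv_cong)
    fix j show "theta (n - (2 * n - j) - 1) = - theta (n - j - 1)"
      using theta_refl[of "n - j - 1"] by (simp add: algebra_simps)
  qed simp
  finally show ?thesis
    by (simp add: conv_minus)
qed

text \<open>Inserting q^j changes nothing, since the difference lowers to
  \<open>conv_theta_eq_0\<close>. With q^j inserted, \<open>theta_step\<close> gives a sum whose
  reversal is \<open>- h\<close> plus an alternating part, so \<open>2 * h\<close> is known.\<close>

lemma conv_theta_odd: "conv (2 * n + 1) (\<lambda>j. theta (n - j)) = (-1) powi n * alt (2 * n)"
proof -
  define h where "h = conv (2 * n + 1) (\<lambda>j. q powi j * theta (n - j))"
  define s where "s = conv (2 * n + 1) (\<lambda>j. (-1) powi j * q powi j)"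
  have "conv (2 * n + 1) (\<lambda>j. (1 - q powi j) * theta (n - j)) = 0"
    unfolding conv_left using conv_theta_eq_0[of n] by (simp add: algebra_simps)
  hence eq: "conv (2 * n + 1) (\<lambda>j. theta (n - j)) = h"
    by (simp add: h_def left_diff_distrib conv_diff)
  have "h = conv (2 * n + 1) (\<lambda>j. q powi (2 * n + 1 - j) * theta (n - j - 1) +
      (-1) powi n * ((-1) powi j * q powi j - (-1) powi j * q powi (2 * n + 1 - j)))"
    unfolding h_def
  proof (rule conv_cong)
    fix j
    have e: "q powi (2 * n + 1 - j) = q powi j * q powi (2 * (n - j) + 1)"
      unfolding q_powi_add[symmetric] by (simp add: algebra_simps)
    show "q powi j * theta (n - j) = q powi (2 * n + 1 - j) * theta (n - j - 1) +
      (-1) powi n * ((-1) powi j * q powi j - (-1) powi j * q powi (2 * n + 1 - j))"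
      unfolding theta_step[of "n - j"] m1_powi_diff e by (simp add: ring_distribs mult_ac)
  qed simp
  also have "\<dots> = conv (2 * n + 1) (\<lambda>j. q powi (2 * n + 1 - j) * theta (n - j - 1)) +
      (-1) powi n * (s - conv (2 * n + 1) (\<lambda>j. (-1) powi j * q powi (2 * n + 1 - j)))"
    by (simp add: conv_add conv_cmult conv_diff s_def)
  also have "conv (2 * n + 1) (\<lambda>j. q powi (2 * n + 1 - j) * theta (n - j - 1)) = - h"
    unfolding h_def conv_minus[symmetric]
  proof (subst conv_flip, rule conv_cong)
    fix j show "q powi (2 * n + 1 - (2 * n + 1 - j)) * theta (n - (2 * n + 1 - j) - 1) =
        - (q powi j * theta (n - j))"
      using theta_refl[of "n - j"] by (simp add: algebra_simps)
  qed simp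
  also have "conv (2 * n + 1) (\<lambda>j. (-1) powi j * q powi (2 * n + 1 - j)) = - s"
    unfolding s_def conv_minus[symmetric]
    by (subst conv_flip, rule conv_cong)
       (auto simp: m1_powi_diff m1_powi_add power_int_mult)
  finally have "2 * h = 2 * ((-1) powi n * s)"
    by (simp add: algebra_simps)
  hence "h = (-1) powi n * s"
    by simp
  thus ?thesis
    unfolding eq by (simp add: s_def conv_alt_q alt_odd)
qed

text \<open>The part with 1 - q^j lowers to the odd case \<open>h\<close>. The part with q^j
  becomes, by \<open>theta_step\<close>, \<open>- (q * h)\<close> plus alternating sums. Finally
  \<open>alt (2 * n) - alt (2 * n - 2)\<close> is q^(2n) \<open>alt (2 * n)\<close> by
  \<open>alt_step\<close>.\<close>

lemma conv_theta_even: "conv (2 * n) (\<lambda>j. theta (n - j)) = (1 - q) * hcoeff n"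
proof -
  define h where "h = conv (2 * n - 1) (\<lambda>j. theta (n - 1 - j))"
  define s where "s = conv (2 * n) (\<lambda>j. (-1) powi j * q powi j)"
  have h: "h = - ((-1) powi n * alt (2 * n - 2))"
    using conv_theta_odd[of "n - 1"] by (simp add: h_def algebra_simps m1_powi_diff)
  have s: "s = alt (2 * n)"
    by (simp add: s_def conv_alt_q alt_odd)
  have "conv (2 * n) (\<lambda>j. (1 - q powi (2 * n - j)) * theta (n - j - 1)) = h"
    unfolding conv_right h_def by (simp add: algebra_simps)
  hence b: "conv (2 * n) (\<lambda>j. q powi (2 * n - j) * theta (n - j - 1)) = - h"
    using conv_theta_eq_0[of n] by (simp add: left_diff_distrib conv_diff minus_equation_iff)
  have "conv (2 * n) (\<lambda>j. (1 - q powi j) * theta (n - j)) = h"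
    unfolding conv_left h_def by (simp add: algebra_simps)
  hence "conv (2 * n) (\<lambda>j. theta (n - j)) = h + conv (2 * n) (\<lambda>j. q powi j * theta (n - j))"
    by (simp add: left_diff_distrib conv_diff diff_eq_eq)
  also have "conv (2 * n) (\<lambda>j. q powi j * theta (n - j)) =
    conv (2 * n) (\<lambda>j. q * (q powi (2 * n - j) * theta (n - j - 1)) +
      (-1) powi n * ((-1) powi j * q powi j - q * ((-1) powi j * q powi (2 * n - j))))"
  proof (rule conv_cong)
    fix j
    have "q powi j * q powi (2 * (n - j) + 1) = q powi (1 + (2 * n - j))"
      unfolding q_powi_add[symmetric] by (simp add: algebra_simps)
    hence "q * q powi (2 * n - j) = q powi j * q powi (2 * (n - j) + 1)"
      by (simp only: q_powi_add) simp
    hence e: "q * (q powi (2 * n - j) * x) = q powi j * q powi (2 * (n - j) + 1) * x"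
      "q * ((-1) powi j * q powi (2 * n - j)) =
        (-1) powi j * (q powi j * q powi (2 * (n - j) + 1))" for x
      by (simp_all add: mult_ac)
    show "q powi j * theta (n - j) = q * (q powi (2 * n - j) * theta (n - j - 1)) +
      (-1) powi n * ((-1) powi j * q powi j - q * ((-1) powi j * q powi (2 * n - j)))"
      unfolding theta_step[of "n - j"] m1_powi_diff e by (simp add: ring_distribs mult_ac)
  qed simp
  also have "\<dots> = - (q * h) + (-1) powi n * (s - q * conv (2 * n) (\<lambda>j. (-1) powi j * q powi (2 * n - j)))"
    unfolding conv_add conv_cmult conv_diff b s_def by simp
  also have "conv (2 * n) (\<lambda>j. (-1) powi j * q powi (2 * n - j)) = s"
    unfolding s_def
    by (subst conv_flip, rule conv_cong) (auto simp: m1_powi_diff power_int_mult)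
  finally have "conv (2 * n) (\<lambda>j. theta (n - j)) =
      (1 - q) * ((-1) powi n * (alt (2 * n) - alt (2 * n - 2)))"
    by (simp add: h s algebra_simps)
  thus ?thesis
    unfolding hcoeff_def alt_step[symmetric] by (simp add: algebra_simps)
qed

section \<open>Weighted paths\<close>

text \<open>In terms of the functional $L$, \<open>cheb m\<close> is $L(U_m)$, \<open>chebx m n\<close> is $L(x^n U_m)$,
  \<open>herm k n\<close> is $L(x^n H_k)/(q;q)_k$, and the array \<open>w h n\<close> of weighted path counts is
  $L(x^n P_h)/(q;q)_h$.\<close>

definition cheb :: "int \<Rightarrow> 'a" where
  "cheb m = (if even m then (theta (m div 2) + theta (m div 2 - 1)) / (1 - q) else 0)"

definition chebx :: "int \<Rightarrow> nat \<Rightarrow> 'a" where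
  "chebx m n = (\<Sum>k\<le>n. of_nat (n choose k) * cheb (m + int n - 2 * int k))"

lemma chebx_0 [simp]: "chebx m 0 = cheb m"
  by (simp add: chebx_def)

text \<open>The rule x U_m = U_(m+1) + U_(m-1), obtained from Pascal's rule.\<close>

lemma chebx_Suc: "chebx m (Suc n) = chebx (m + 1) n + chebx (m - 1) n"
  unfolding chebx_def sum_choose_Suc by (simp add: sum.distrib ring_distribs algebra_simps)

definition herm :: "int \<Rightarrow> nat \<Rightarrow> 'a" where
  "herm k n = conv k (\<lambda>j. chebx (k - 2 * j) n)"

text \<open>The recurrence of the H_k divided by (q;q)_k, with H_k written as the sum of [k, j]
  U_(k-2j), negative indices included.\<close>

lemma herm_Suc: "herm k (Suc n) = (1 - q powi (k + 1)) * herm (k + 1) n + herm (k - 1) n"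
proof -
  define F where "F j = chebx (k + 1 - 2 * j) n" for j
  have "herm k (Suc n) = conv k F + conv k (\<lambda>j. F (j + 1))"
    unfolding herm_def chebx_Suc conv_add
    by (intro arg_cong2[of _ _ _ _ "(+)"] conv_cong) (simp_all add: F_def algebra_simps)
  also have "conv k F = conv (k + 1) (\<lambda>j. (1 - q powi (k + 1 - j)) * F j)"
    unfolding conv_right by simp
  also have "conv k (\<lambda>j. F (j + 1)) = conv (k + 1) (\<lambda>j. (1 - q powi j) * F j)"
    unfolding conv_left by simp
  \<comment> \<open>Uses (1 - u) + (1 - v) = (1 - u v) + (1 - u)(1 - v) with u = q^j, v = q^(k+1-j);
    the product term lowers twice, to \<open>k - 1\<close>.\<close>
  also have "conv (k + 1) (\<lambda>j. (1 - q powi (k + 1 - j)) * F j) +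
      conv (k + 1) (\<lambda>j. (1 - q powi j) * F j) =
      conv (k + 1) (\<lambda>j. (1 - q powi (k + 1)) * F j +
        (1 - q powi j) * ((1 - q powi (k + 1 - j)) * F j))"
    unfolding conv_add[symmetric]
  proof (rule conv_cong)
    fix j
    have "q powi (k + 1) = q powi j * q powi (k + 1 - j)"
      unfolding q_powi_add[symmetric] by simp
    thus "(1 - q powi (k + 1 - j)) * F j + (1 - q powi j) * F j = (1 - q powi (k + 1)) * F j +
        (1 - q powi j) * ((1 - q powi (k + 1 - j)) * F j)"
      by algebra
  qed simp
  also have "\<dots> = (1 - q powi (k + 1)) * herm (k + 1) n +
      conv k (\<lambda>j. (1 - q powi (k - j)) * F (j + 1))"
    unfolding conv_add conv_cmult conv_left by (simp add: herm_def F_def)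
  also have "conv k (\<lambda>j. (1 - q powi (k - j)) * F (j + 1)) = herm (k - 1) n"
    unfolding conv_right herm_def by (simp add: F_def algebra_simps)
  finally show ?thesis .
qed

lemma q_neq_1: "q \<noteq> 1"
  using q_pow[of 1] by simp

text \<open>The values L(H_k) from the theta side: the two thetas in \<open>cheb\<close> fall under
  \<open>conv_theta_even\<close> and \<open>conv_theta_eq_0\<close>.\<close>

lemma herm_0: "herm k 0 = (if even k then hcoeff (k div 2) else 0)"
proof (cases "even k")
  case True
  then obtain i where k: "k = 2 * i" by auto
  have "herm k 0 = conv (2 * i) (\<lambda>j. inverse (1 - q) * (theta (i - j) + theta (i - j - 1)))"
    unfolding herm_def
  proof (rule conv_cong)
    fix j
    have "(k - 2 * j) div 2 = i - j" "even (k - 2 * j)" by (auto simp: k)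
    thus "chebx (k - 2 * j) 0 = inverse (1 - q) * (theta (i - j) + theta (i - j - 1))"
      by (simp add: cheb_def divide_inverse mult_ac)
  qed (simp add: k)
  also have "\<dots> = hcoeff i"
    unfolding conv_cmult conv_add conv_theta_even conv_theta_eq_0 using q_neq_1 by simp
  finally show ?thesis
    by (simp add: k)
next
  case False
  thus ?thesis
    by (simp add: herm_def cheb_def conv_def)
qed

text \<open>\<open>w_0\<close> is L(P_h) = 0 for h > 0, and \<open>w_Suc\<close> is the recurrence
  of the P_h divided by (q;q)_h. At \<open>h = -1\<close> its factor is 0, in agreement with
  \<open>w_neg\<close>.\<close>

context
  fixes w :: "int \<Rightarrow> nat \<Rightarrow> 'a"
  assumes w_0: "\<And>h. w h 0 = (if h = 0 then 1 else 0)"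
    and w_Suc: "\<And>h n. w h (Suc n) = (1 - q powi (h + 1)) * (w (h + 1) n + w (h - 1) n)"
    and w_neg: "\<And>h n. h < 0 \<Longrightarrow> w h n = 0"
begin

text \<open>The expansion of H_k in the P_h, under L. Both sides agree at \<open>n = 0\<close> by
  \<open>herm_0\<close>, and the right side also obeys \<open>herm_Suc\<close>.\<close>

lemma herm_eq_paths: "herm k n = (\<Sum>j=0..k. hcoeff j * w (k - 2 * j) n)"
proof (induction n arbitrary: k)
  case 0
  have "(\<Sum>j=0..k. hcoeff j * w (k - 2 * j) 0) =
      (\<Sum>j=0..k. if even k \<and> j = k div 2 then hcoeff (k div 2) else 0)"
    by (rule sum.cong) (auto simp: w_0)
  also have "\<dots> = (if even k then hcoeff (k div 2) else 0)"
    by (auto simp: sum.delta)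
  finally show ?case
    by (simp add: herm_0)
next
  case (Suc n)
  show ?case
  proof (cases "k \<ge> 0")
    case False
    thus ?thesis by (simp add: herm_def)
  next
    case True
    \<comment> \<open>One sequence holds both neighbours: \<open>v j\<close> is the upper one and
      \<open>v (j + 1)\<close> the lower one.\<close>
    define v where "v j = w (k + 1 - 2 * j) n" for j
    have v_0: "v (k + 1) = 0"
      using True by (simp add: v_def w_neg)
    have ins: "{0..k + 1} = insert (k + 1) {0..k}"
      using True by auto
    have shift: "(\<Sum>j=0..k. hcoeff j * F (j + 1) * v (j + 1)) =
        (\<Sum>j=0..k+1. hcoeff (j - 1) * F j * v j)" for F
    proof -
      have "(\<Sum>j=0..k. hcoeff j * F (j + 1) * v (j + 1)) =
          (\<Sum>j=1..k+1. hcoeff (j - 1) * F j * v j)"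
        using sum_int_shift[of "\<lambda>j. hcoeff (j - 1) * F j * v j" 1 0 k] by simp
      also have "\<dots> = (\<Sum>j=0..k+1. hcoeff (j - 1) * F j * v j)"
        by (rule sum.mono_neutral_left) auto
      finally show ?thesis .
    qed
    \<comment> \<open>The second exponent is written in \<open>j + 1\<close> so that
      \<open>shift\<close> applies.\<close>
    have "(\<Sum>j=0..k. hcoeff j * w (k - 2 * j) (Suc n)) =
        (\<Sum>j=0..k. hcoeff j * (1 - q powi (k + 1 - 2 * j)) * v j) +
        (\<Sum>j=0..k. hcoeff j * (1 - q powi (k + 3 - 2 * (j + 1))) * v (j + 1))"
      unfolding w_Suc sum.distrib[symmetric]
      by (rule sum.cong) (auto simp: v_def algebra_simps)
    also have "(\<Sum>j=0..k. hcoeff j * (1 - q powi (k + 1 - 2 * j)) * v j) =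
        (\<Sum>j=0..k+1. hcoeff j * (1 - q powi (k + 1 - 2 * j)) * v j)"
      by (simp add: ins v_0)
    also have "(\<Sum>j=0..k. hcoeff j * (1 - q powi (k + 3 - 2 * (j + 1))) * v (j + 1)) =
        (\<Sum>j=0..k+1. hcoeff (j - 1) * (1 - q powi (k + 3 - 2 * j)) * v j)"
      by (rule shift)
    also have "(\<Sum>j=0..k+1. hcoeff j * (1 - q powi (k + 1 - 2 * j)) * v j) +
        (\<Sum>j=0..k+1. hcoeff (j - 1) * (1 - q powi (k + 3 - 2 * j)) * v j) =
        (1 - q powi (k + 1)) * (\<Sum>j=0..k+1. hcoeff j * v j) +
        (\<Sum>j=0..k+1. hcoeff (j - 1) * 1 * v j)"
      unfolding sum_distrib_left sum.distrib[symmetric]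
    proof (rule sum.cong)
      fix j
      \<comment> \<open>The coefficients of \<open>v j\<close> differ by a multiple q^(k+1-2j) of
        \<open>hcoeff_step\<close>.\<close>
      have "q powi (k + 1) = q powi (k + 1 - 2 * j) * q powi (2 * j)"
        "q powi (k + 3 - 2 * j) = q powi (k + 1 - 2 * j) * q\<^sup>2"
        using q_powi_add[of "k + 1 - 2 * j" "2 * j"] q_powi_add[of "k + 1 - 2 * j" 2]
        by (simp_all add: algebra_simps)
      thus "hcoeff j * (1 - q powi (k + 1 - 2 * j)) * v j +
          hcoeff (j - 1) * (1 - q powi (k + 3 - 2 * j)) * v j =
          (1 - q powi (k + 1)) * (hcoeff j * v j) + hcoeff (j - 1) * 1 * v j"
        using hcoeff_step[of j] by algebra
    qed simp
    also have "(\<Sum>j=0..k+1. hcoeff (j - 1) * 1 * v j) = (\<Sum>j=0..k. hcoeff j * 1 * v (j + 1))"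
      by (rule shift[symmetric])
    also have "\<dots> = (\<Sum>j=0..k-1. hcoeff j * w (k - 1 - 2 * j) n)"
    proof -
      have "{0..k} = insert k {0..k - 1}"
        using True by auto
      thus ?thesis
        using True by (simp add: v_def w_neg algebra_simps)
    qed
    finally show ?thesis
      by (simp add: herm_Suc Suc.IH v_def)
  qed
qed

text \<open>The case \<open>k = 0\<close> of \<open>herm_eq_paths\<close>. Each \<open>cheb\<close>
  splits into adjacent thetas, which Pascal's rule merges into row \<open>2 * N + 1\<close>.\<close>

lemma paths_even:
  "(1 - q) * w 0 (2 * N) =
    (\<Sum>k\<le>2 * N + 1. of_nat ((2 * N + 1) choose k) * theta (int N - int k))"
proof -
  have "w 0 (2 * N) = (\<Sum>k\<le>2 * N. of_nat (2 * N choose k) * cheb (int (2 * N) - 2 * int k))"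
    using herm_eq_paths[of 0 "2 * N"] by (simp add: herm_def chebx_def hcoeff_def)
  also have "\<dots> = (\<Sum>k\<le>2 * N. of_nat (2 * N choose k) *
      (theta (int N - int k) + theta (int N - int (Suc k)))) / (1 - q)"
    unfolding sum_divide_distrib
  proof (rule sum.cong)
    fix k
    have "int (2 * N) - 2 * int k = 2 * (int N - int k)" by simp
    thus "of_nat (2 * N choose k) * cheb (int (2 * N) - 2 * int k) =
        of_nat (2 * N choose k) * (theta (int N - int k) + theta (int N - int (Suc k))) / (1 - q)"
      by (simp add: cheb_def algebra_simps)
  qed simp
  finally show ?thesis
    using q_neq_1 sum_choose_Suc[of "2 * N" "\<lambda>k. theta (int N - int k)"] by simp
qed

end

text \<open>Oddness of \<open>theta\<close> pairs \<open>k = N - m\<close> with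
  \<open>k = N + m + 2\<close>, leaving a difference of binomials, a ballot number.\<close>

lemma theta_sum_fold:
  "(\<Sum>k\<le>2 * N + 1. of_nat ((2 * N + 1) choose k) * theta (int N - int k)) =
   (\<Sum>m=0..N. ptheta (int m) * of_nat (2 * m + 2) * of_nat ((2 * N + 1) choose (N + m + 1)) /
     of_nat (N + m + 2))"
proof -
  define b where "b k = (of_nat ((2 * N + 1) choose k) :: 'a)" for k
  have "(\<Sum>k\<le>2 * N + 1. b k * theta (int N - int k)) =
      (\<Sum>k\<le>N. b k * theta (int N - int k)) + (\<Sum>k=N+1..2*N+1. b k * theta (int N - int k))"
  proof -
    have "{..2 * N + 1} = {..N} \<union> {N+1..2*N+1}" by auto
    thus ?thesis
      by (simp only:) (rule sum.union_disjoint; auto)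
  qed
  also have "(\<Sum>k\<le>N. b k * theta (int N - int k)) = (\<Sum>m=0..N. b (N - m) * ptheta (int m))"
    by (rule sum.reindex_bij_witness[of _ "\<lambda>m. N - m" "\<lambda>k. N - k"])
       (auto simp: theta_def of_nat_diff)
  \<comment> \<open>The term \<open>N + 1\<close> has \<open>theta (-1) = 0\<close> and the term
    \<open>2 * N + 2\<close> a zero binomial; the exchange makes both halves run over
    \<open>m = 0..N\<close>.\<close>
  also have "(\<Sum>k=N+1..2*N+1. b k * theta (int N - int k)) =
      (\<Sum>k=N+2..2*N+2. b k * theta (int N - int k))"
  proof -
    have "{N+1..2*N+1} = insert (N+1) {N+2..2*N+1}" "{N+2..2*N+2} = insert (2*N+2) {N+2..2*N+1}"
      by auto
    thus ?thesis
      by (simp add: theta_def b_def binomial_eq_0)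
  qed
  also have "\<dots> = (\<Sum>m=0..N. - b (N + m + 2) * ptheta (int m))"
  proof (rule sum.reindex_bij_witness[of _ "\<lambda>m. N + m + 2" "\<lambda>k. k - (N + 2)"])
    fix k assume "k \<in> {N+2..2*N+2}"
    then obtain m where m: "k = N + m + 2"
      by (metis add.assoc add.commute atLeastAtMost_iff le_Suc_ex)
    have "int N - int k = - 2 - int m" by (simp add: m)
    thus "- b (N + (k - (N + 2)) + 2) * ptheta (int (k - (N + 2))) = b k * theta (int N - int k)"
      using theta_refl[of "int m"] by (simp add: m theta_def)
  qed auto
  also have "(\<Sum>m=0..N. b (N - m) * ptheta (int m)) + (\<Sum>m=0..N. - b (N + m + 2) * ptheta (int m)) =
      (\<Sum>m=0..N. ptheta (int m) * of_nat (2 * m + 2) * b (N + m + 1) / of_nat (N + m + 2))"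
    unfolding sum.distrib[symmetric]
  proof (rule sum.cong)
    fix m assume "m \<in> {0..N}"
    hence m: "m \<le> N" by simp
    have sym: "b (N - m) = b (N + m + 1)"
      using binomial_symmetric[of "N - m" "2 * N + 1"] m by (simp add: b_def)
    have "Suc (N + m + 1) * ((2 * N + 1) choose Suc (N + m + 1)) =
        (2 * N + 1 - (N + m + 1)) * ((2 * N + 1) choose (N + m + 1))"
      by (metis binomial_absorb_comp binomial_absorption)
    hence "(of_nat (Suc (N + m + 1)) :: 'a) * b (N + m + 2) = of_nat (N - m) * b (N + m + 1)"
      unfolding b_def of_nat_mult[symmetric] using m by simp
    moreover have "(of_nat (N + m + 2) :: 'a) \<noteq> 0"
      unfolding of_nat_eq_0_iff by simp
    ultimately have "b (N + m + 2) = of_nat (N - m) / of_nat (N + m + 2) * b (N + m + 1)"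
      by (simp add: field_simps)
    moreover have "(of_nat (N - m) :: 'a) / of_nat (N + m + 2) = 1 - of_nat (2 * m + 2) / of_nat (N + m + 2)"
      using \<open>(of_nat (N + m + 2) :: 'a) \<noteq> 0\<close> m by (simp add: field_simps of_nat_diff)
    ultimately have "b (N + m + 2) = (1 - of_nat (2 * m + 2) / of_nat (N + m + 2)) * b (N + m + 1)"
      by (simp only:)
    thus "b (N - m) * ptheta (int m) + - b (N + m + 2) * ptheta (int m) =
        ptheta (int m) * of_nat (2 * m + 2) * b (N + m + 1) / of_nat (N + m + 2)"
      unfolding sym by (simp only:) (simp add: ring_distribs mult_ac divide_inverse)
  qed simp
  finally show ?thesis
    by (simp add: b_def)
qed

end

section \<open>Path diagrams\<close>

text \<open>Arbitrary start height and length, so that first steps can be peeled off. One bound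
  serves both labels because \<open>pos\<close> is the height in either case.\<close>

definition diagrams_from :: "int \<Rightarrow> nat \<Rightarrow> (step list \<times> nat list) set" where
  "diagrams_from h n = {(p, s). length p = n \<and> length s = n \<and> (\<forall>i\<le>n. h + height p i \<ge> 0) \<and>
     h + height p n = 0 \<and> (\<forall>i<n. s ! i \<le> nat (h + height p i))}"

lemma height_0 [simp]: "height p 0 = 0"
  by (simp add: height_def)

lemma height_Cons_Suc [simp]: "height (x # p) (Suc i) = step_rise x + height p i"
  by (simp add: height_def sum.lessThan_Suc_shift del: sum.lessThan_Suc)

lemma height_length: "height p (length p) = int (count_list p Up) - int (count_list p Down)"
  by (induction p) (auto split: if_splits step.splits intro: step_rise.cases)

lemma count_steps: "count_list p Up + count_list p Down = length p"
proof (induction p)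
  case (Cons x p)
  thus ?case by (cases x) auto
qed simp

lemma path_diagrams_eq: "path_diagrams pos N = diagrams_from 0 (2 * N)"
proof -
  have "pos (step_label p i) = nat (height p i)" for p i
    by (auto simp: step_label_def split: step.splits)
  moreover have "length p = 2 * N \<and> count_list p Up = N \<and> count_list p Down = N \<longleftrightarrow>
      length p = 2 * N \<and> height p (2 * N) = 0" for p
    using height_length[of p] count_steps[of p] by auto
  ultimately show ?thesis
    unfolding path_diagrams_def diagrams_from_def dyck_paths_def by auto
qed

lemma diagrams_from_0: "diagrams_from h 0 = (if h = 0 then {([], [])} else {})"
  by (auto simp: diagrams_from_def)

lemma diagrams_from_neg: "h < 0 \<Longrightarrow> diagrams_from h n = {}"
  by (force simp: diagrams_from_def)

lemma diagrams_from_Cons: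
  "(x # p, a # s) \<in> diagrams_from h (Suc n) \<longleftrightarrow>
    h \<ge> 0 \<and> a \<le> nat h \<and> (p, s) \<in> diagrams_from (h + step_rise x) n"
  unfolding diagrams_from_def
  by (simp add: All_less_Suc2 less_Suc_eq_le[symmetric] add.assoc del: All_less_Suc) blast

definition cons_diagram :: "step \<Rightarrow> nat \<times> step list \<times> nat list \<Rightarrow> step list \<times> nat list" where
  "cons_diagram x = (\<lambda>(a, p, s). (x # p, a # s))"

lemma diagrams_from_Suc:
  assumes "h \<ge> 0"
  shows "diagrams_from h (Suc n) =
    cons_diagram Up ` ({..nat h} \<times> diagrams_from (h + 1) n) \<union>
    cons_diagram Down ` ({..nat h} \<times> diagrams_from (h - 1) n)"
proof (intro set_eqI iffI)
  fix d assume d: "d \<in> diagrams_from h (Suc n)"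
  then obtain x p a s where eq: "d = (x # p, a # s)"
    by (cases d; cases "fst d"; cases "snd d") (auto simp: diagrams_from_def)
  show "d \<in> cons_diagram Up ` ({..nat h} \<times> diagrams_from (h + 1) n) \<union>
    cons_diagram Down ` ({..nat h} \<times> diagrams_from (h - 1) n)"
    using d unfolding eq diagrams_from_Cons
    by (cases x) (force simp: cons_diagram_def)+
next
  fix d assume "d \<in> cons_diagram Up ` ({..nat h} \<times> diagrams_from (h + 1) n) \<union>
    cons_diagram Down ` ({..nat h} \<times> diagrams_from (h - 1) n)"
  thus "d \<in> diagrams_from h (Suc n)"
    using assms by (auto simp: cons_diagram_def diagrams_from_Cons)
qed

lemma finite_diagrams_from [simp]: "finite (diagrams_from h n)"
proof (induction n arbitrary: h)
  case 0
  thus ?case by (simp add: diagrams_from_0)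
next
  case (Suc n)
  thus ?case
    by (cases "h \<ge> 0") (auto simp: diagrams_from_Suc diagrams_from_neg)
qed

section \<open>Generating functions of diagrams and their recurrence\<close>

definition diagram_gf :: "int \<Rightarrow> nat \<Rightarrow> rat fps" where
  "diagram_gf h n = (\<Sum>(p, s)\<in>diagrams_from h n. fps_X ^ sum_list s)"

lemma diagram_gf_0: "diagram_gf h 0 = (if h = 0 then 1 else 0)"
  by (simp add: diagram_gf_def diagrams_from_0)

lemma diagram_gf_neg: "h < 0 \<Longrightarrow> diagram_gf h n = 0"
  by (simp add: diagram_gf_def diagrams_from_neg)

text \<open>The choices for the first integer do not depend on the step's direction. At
  \<open>h = 0\<close> the down-step contributes 0.\<close>

lemma diagram_gf_Suc:
  assumes "h \<ge> 0"
  shows "diagram_gf h (Suc n) = (\<Sum>a\<le>nat h. fps_X ^ a) * (diagram_gf (h + 1) n + diagram_gf (h - 1) n)"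
proof -
  have *: "(\<Sum>(p, s)\<in>cons_diagram x ` ({..nat h} \<times> D). fps_X ^ sum_list s) =
      (\<Sum>a\<le>nat h. fps_X ^ a) * (\<Sum>(p, s)\<in>D. fps_X ^ sum_list s :: rat fps)" for x D
    by (subst sum.reindex)
       (auto simp: cons_diagram_def inj_on_def sum_product sum.cartesian_product power_add
         intro!: sum.cong)
  have "diagram_gf h (Suc n) =
      (\<Sum>(p, s)\<in>cons_diagram Up ` ({..nat h} \<times> diagrams_from (h + 1) n). fps_X ^ sum_list s) +
      (\<Sum>(p, s)\<in>cons_diagram Down ` ({..nat h} \<times> diagrams_from (h - 1) n). fps_X ^ sum_list s)"
    unfolding diagram_gf_def diagrams_from_Suc[OF assms]
    by (rule sum.union_disjoint) (auto simp: cons_diagram_def)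
  thus ?thesis
    unfolding * by (simp add: diagram_gf_def ring_distribs)
qed

lemma fps_nth_G: "fps_nth G (2 * N) = diagram_gf 0 (2 * N)"
proof (rule fps_ext)
  fix m
  have "fps_nth (diagram_gf 0 (2 * N)) m =
      (\<Sum>d\<in>diagrams_from 0 (2 * N). if sum_list (snd d) = m then 1 else 0)"
    by (auto simp: diagram_gf_def fps_sum_nth case_prod_unfold fps_X_power_nth intro!: sum.cong)
  also have "\<dots> = of_nat (card {d \<in> diagrams_from 0 (2 * N). sum_list (snd d) = m})"
    by (simp flip: sum.inter_filter)
  also have "{d \<in> diagrams_from 0 (2 * N). sum_list (snd d) = m} =
      {(p, s) \<in> path_diagrams pos N. sum_list s = m}"
    by (auto simp: path_diagrams_eq)
  finally show "fps_nth (fps_nth G (2 * N)) m = fps_nth (diagram_gf 0 (2 * N)) m"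
    by (simp add: G_def num_diagrams_def)
qed

text \<open>One factor 1 - q per step turns the weight 1 + ... + q^h into 1 - q^(h+1); this is the
  array \<open>w\<close>.\<close>

definition scaled_gf :: "int \<Rightarrow> nat \<Rightarrow> rat fls" where
  "scaled_gf h n = (1 - fls_X) ^ n * fps_to_fls (diagram_gf h n)"

lemma scaled_gf_Suc:
  "scaled_gf h (Suc n) = (1 - fls_X powi (h + 1)) * (scaled_gf (h + 1) n + scaled_gf (h - 1) n)"
proof (cases "h \<ge> 0")
  case True
  have "(1 - fls_X) * fps_to_fls (\<Sum>a\<le>nat h. fps_X ^ a :: rat fps) = 1 - fls_X powi (h + 1)"
  proof -
    have "(1 - fps_X) * (\<Sum>a\<le>nat h. fps_X ^ a :: rat fps) = 1 - fps_X ^ (Suc (nat h))"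
      by (simp only: sum_gp_basic)
    hence "fps_to_fls ((1 - fps_X) * (\<Sum>a\<le>nat h. fps_X ^ a :: rat fps)) = 1 - fls_X ^ (Suc (nat h))"
      by (simp add: fps_to_fls_power del: power_Suc)
    moreover have "nat (h + 1) = Suc (nat h)"
      using True by simp
    ultimately show ?thesis
      using True by (simp add: fls_times_fps_to_fls power_int_def)
  qed
  moreover have "scaled_gf h (Suc n) = ((1 - fls_X) * fps_to_fls (\<Sum>a\<le>nat h. fps_X ^ a :: rat fps)) *
      (scaled_gf (h + 1) n + scaled_gf (h - 1) n)"
    by (simp add: scaled_gf_def diagram_gf_Suc True fls_times_fps_to_fls algebra_simps)
  ultimately show ?thesis
    by simp
next
  \<comment> \<open>At \<open>h = -1\<close> the factor 1 - q^0 kills the nonzero neighbour at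
    height 0; below that both neighbours vanish.\<close>
  case False
  thus ?thesis
    by (cases "h = -1") (auto simp: scaled_gf_def diagram_gf_neg)
qed

theorem corollary1p4:
  fixes N :: nat
  defines "q \<equiv> (fls_X :: rat fls)"
  shows "fps_to_fls (fps_nth G (2 * N)) =
    1 / (1 - q) ^ (2 * N + 1) *
    (\<Sum>m = 0..N.
       q ^ (m\<^sup>2 + 2 * m) *
       (\<Sum>l = - int m..int m + 1. (-1) powi l * q powi (- (l\<^sup>2) + 2 * l)) *
       of_nat (2 * m + 2) * of_nat ((2 * N + 1) choose (N + m + 1)) /
       of_nat (N + m + 2))"
proof -
  interpret q_param "fls_X :: rat fls"
  proof
    fix n :: nat assume n: "n > 0"
    have "fls_nth (fls_X ^ n :: rat fls) 0 \<noteq> fls_nth 1 0"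
      using n by simp
    thus "(fls_X ^ n :: rat fls) \<noteq> 1" by metis
  qed simp
  have pth: "q ^ (m\<^sup>2 + 2 * m) * (\<Sum>l = - int m..int m + 1. (-1) powi l * q powi (- (l\<^sup>2) + 2 * l)) =
      ptheta (int m)" for m
  proof -
    have "(int m)\<^sup>2 + 2 * int m = int (m\<^sup>2 + 2 * m)" by simp
    thus ?thesis
      unfolding ptheta_def q_def by (simp only: power_int_of_nat)
  qed
  \<comment> \<open>\<open>scaled_gf\<close> is taken for \<open>w\<close>; its scaling (1 - q)^(2N)
    and the extra factor here give the exponent \<open>2 * N + 1\<close>.\<close>
  have "(1 - q) * scaled_gf 0 (2 * N) =
      (\<Sum>k\<le>2 * N + 1. of_nat ((2 * N + 1) choose k) * theta (int N - int k))"
    unfolding q_def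
    by (rule paths_even) (simp_all add: scaled_gf_Suc, simp_all add: scaled_gf_def diagram_gf_0 diagram_gf_neg)
  hence "(1 - q) ^ (2 * N + 1) * fps_to_fls (fps_nth G (2 * N)) =
      (\<Sum>m=0..N. ptheta (int m) * of_nat (2 * m + 2) * of_nat ((2 * N + 1) choose (N + m + 1)) /
     of_nat (N + m + 2))"
    unfolding theta_sum_fold by (simp add: scaled_gf_def q_def fps_nth_G mult.assoc)
  moreover have "(1 - q) ^ (2 * N + 1) \<noteq> 0"
    using q_neq_1 by (simp add: q_def)
  ultimately show ?thesis
    unfolding pth by (simp add: field_simps)
qed

end
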